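(* For every $n$, let $T$ be a random tournament on $n$ alternatives generated according to the Condorcet random model with parameter $p=p(n)$ satisfying $p \le 0.1\log n/n$. Then with high probability (i.e., with probability tending to $1$ as $n\to\infty$), at most $\sqrt{n}\log n$ alternatives in $T$ are $2$-kings.
   Context: A tournament on a finite set $V$ of alternatives is a complete orientation: for every two distinct $x,y\in V$ exactly one of $x\succ y$ ("$x$ dominates $y$") or $y\succ x$ holds. An alternative $x$ is a $2$-king if for every other alternative $y$ there is a directed path from $x$ to $y$ of length at most $2$. Condorcet random model with parameter $0\le p\le 1/2$: alternatives are $x_1,\dots,x_n$; independently for each pair $i<j$, $x_j\succ x_i$ with probability $p$ and $x_i\succ x_j$ with probability $1-p$. $\log$ is the natural logarithm. *)

theory Defs
  imports "HOL-Probability.Probability" "Graph_Theory.Pair_Digraph"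
begin

text \<open>An arc \<open>(x, y)\<close> of a tournament means that \<open>x\<close> dominates \<open>y\<close>.\<close>

locale tournament = pair_digraph G for G :: "'a pair_pre_digraph" +
  assumes complete_orientation:
    "\<lbrakk>x \<in> pverts G; y \<in> pverts G; x \<noteq> y\<rbrakk> \<Longrightarrow> (x, y) \<in> parcs G \<longleftrightarrow> (y, x) \<notin> parcs G"

definition two_king :: "'a pair_pre_digraph \<Rightarrow> 'a \<Rightarrow> bool" where
  "two_king G x \<longleftrightarrow> x \<in> pverts G \<and>
     (\<forall>y \<in> pverts G - {x}. \<exists>es. pre_digraph.apath (with_proj G) x es y \<and> length es \<le> 2)"

definition ordered_pairs :: "nat \<Rightarrow> (nat \<times> nat) set" where
  "ordered_pairs n = {(i, j). 1 \<le> i \<and> i < j \<and> j \<le> n}"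

text \<open>The alternative \<open>x\<^sub>i\<close> is represented by its index \<open>i \<in> {1..n}\<close>. For \<open>i < j\<close>, the entry
  \<open>u (i, j)\<close> says whether the pair is reversed, i.e. whether \<open>x\<^sub>j\<close> dominates \<open>x\<^sub>i\<close>.\<close>

definition tournament_of :: "nat \<Rightarrow> (nat \<times> nat \<Rightarrow> bool) \<Rightarrow> nat pair_pre_digraph" where
  "tournament_of n u =
     \<lparr> pverts = {1..n},
       parcs = {(i, j). (i, j) \<in> ordered_pairs n \<and> \<not> u (i, j)} \<union>
               {(j, i). (i, j) \<in> ordered_pairs n \<and> u (i, j)} \<rparr>"

definition condorcet_model :: "nat \<Rightarrow> real \<Rightarrow> nat pair_pre_digraph pmf" where
  "condorcet_model n p =
     map_pmf (tournament_of n) (Pi_pmf (ordered_pairs n) False (\<lambda>_. bernoulli_pmf p))"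

lemma finite_ordered_pairs: "finite (ordered_pairs n)"
  by (rule finite_subset[of _ "{1..n} \<times> {1..n}"]) (auto simp: ordered_pairs_def)

lemma tournament_tournament_of: "tournament (tournament_of n u)"
proof
  show "finite (parcs (tournament_of n u))"
    by (rule finite_subset[of _ "{1..n} \<times> {1..n}"])
       (auto simp: tournament_of_def ordered_pairs_def)
qed (auto simp: tournament_of_def ordered_pairs_def)

lemma tournament_condorcet_model:
  "T \<in> set_pmf (condorcet_model n p) \<Longrightarrow> tournament T"
  by (auto simp: condorcet_model_def intro: tournament_tournament_of)

lemma condorcet_model_prob:
  assumes "1 \<le> i" "i < j" "j \<le> n" "0 \<le> p" "p \<le> 1"
  shows "measure_pmf.prob (condorcet_model n p) {T. (j, i) \<in> parcs T} = p"
    and "measure_pmf.prob (condorcet_model n p) {T. (i, j) \<in> parcs T} = 1 - p"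
proof -
  let ?Q = "Pi_pmf (ordered_pairs n) False (\<lambda>_. bernoulli_pmf p)"
  have ij: "(i, j) \<in> ordered_pairs n"
    using assms by (simp add: ordered_pairs_def)
  have marg: "map_pmf (\<lambda>u. u (i, j)) ?Q = bernoulli_pmf p"
    using ij by (simp add: Pi_pmf_component finite_ordered_pairs)
  have up: "tournament_of n -` {T. (j, i) \<in> parcs T} = (\<lambda>u. u (i, j)) -` {True}"
    and down: "tournament_of n -` {T. (i, j) \<in> parcs T} = (\<lambda>u. u (i, j)) -` {False}"
    using assms by (auto simp: tournament_of_def ordered_pairs_def)
  show "measure_pmf.prob (condorcet_model n p) {T. (j, i) \<in> parcs T} = p"
    using assms unfolding condorcet_model_def measure_map_pmf up
    unfolding measure_map_pmf[symmetric] marg by (simp add: measure_pmf_single)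
  show "measure_pmf.prob (condorcet_model n p) {T. (i, j) \<in> parcs T} = 1 - p"
    using assms unfolding condorcet_model_def measure_map_pmf down
    unfolding measure_map_pmf[symmetric] marg by (simp add: measure_pmf_single)
qed

end

theory Submission
  imports Defs "HOL-Real_Asymp.Real_Asymp"
begin

text \<open>Put \<open>k \<approx> n powr 0.4\<close>. Each of \<open>x\<^sub>1, \<dots>, x\<^sub>k\<close> is dominated by no later alternative with
  probability at least \<open>(1 - p) ^ n \<ge> n powr (- 0.2)\<close>, and these events are independent since they
  concern disjoint sets of pairs; so with high probability some \<open>x\<^sub>j\<close> with \<open>j \<le> k\<close> has this property.
  Every 2-king outside \<open>x\<^sub>1, \<dots>, x\<^sub>k\<close> then has to dominate some \<open>x\<^sub>i\<close> with \<open>i < j\<close>. The expected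
  number of reversed pairs \<open>(i, l)\<close> with \<open>i \<le> k\<close> is at most \<open>k * n * p\<close>, which is of order
  \<open>n powr 0.4 * ln n\<close>, and Markov's inequality concludes.\<close>

section \<open>Deterministic counting of 2-kings\<close>

lemma two_kingD:
  assumes "two_king T x" "y \<in> pverts T" "y \<noteq> x"
  shows "(x, y) \<in> parcs T \<or> (\<exists>z. (x, z) \<in> parcs T \<and> (z, y) \<in> parcs T)"
proof -
  obtain es where es: "pre_digraph.apath (with_proj T) x es y" "length es \<le> 2"
    using assms unfolding two_king_def by blast
  have arcs: "set es \<subseteq> parcs T" and cas: "pre_digraph.cas (with_proj T) x es y"
    using es(1) by (auto simp: pre_digraph.apath_def pre_digraph.awalk_def)
  \<comment> \<open>\<open>remdups_adj.cases\<close> serves only as a case split into lists of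
    length 0, 1 and at least 2.\<close>
  consider "es = []" | a where "es = [a]" | a b where "es = [a, b]"
    using es(2) by (cases es rule: remdups_adj.cases) auto
  then show ?thesis
  proof cases
    case 1
    then show ?thesis using cas assms(3) by (simp add: pre_digraph.cas.simps)
  next
    case 2
    then show ?thesis using cas arcs by (cases a) (auto simp: pre_digraph.cas.simps)
  next
    case 3
    then show ?thesis using cas arcs by (cases a; cases b) (auto simp: pre_digraph.cas.simps)
  qed
qed

text \<open>An alternative \<open>x\<close> ranked after \<open>j\<close> can only reach \<open>j\<close> through some \<open>z < j\<close> dominated by \<open>x\<close>.\<close>

lemma card_two_kings_le:
  assumes j: "j \<in> {1..k}" and k: "k \<le> n"
    and unbeaten: "\<And>l. (j, l) \<in> ordered_pairs n \<Longrightarrow> \<not> u (j, l)"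
  shows "card {x. two_king (tournament_of n u) x}
           \<le> k + card {e \<in> ordered_pairs n. fst e \<le> k \<and> u e}"
proof -
  let ?R = "{e \<in> ordered_pairs n. fst e \<le> k \<and> u e}"
  have fin: "finite ?R"
    using finite_ordered_pairs by simp
  \<comment> \<open>Each 2-king beyond \<open>k\<close> is charged to a reversed pair of which it is
    the larger index, so distinct 2-kings get distinct pairs.\<close>
  have "{x. two_king (tournament_of n u) x} \<subseteq> {1..k} \<union> snd ` ?R"
  proof safe
    fix x assume x: "two_king (tournament_of n u) x" and notin: "x \<notin> snd ` ?R"
    have xn: "x \<in> {1..n}"
      using x by (auto simp: two_king_def tournament_of_def)
    show "x \<in> {1..k}"
    proof (rule ccontr)
      assume "x \<notin> {1..k}"
      with xn j have jx: "j < x" by auto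
      have "(x, j) \<notin> parcs (tournament_of n u)"
        using unbeaten jx by (auto simp: tournament_of_def ordered_pairs_def)
      moreover have "j \<in> pverts (tournament_of n u)"
        using j k by (simp add: tournament_of_def)
      ultimately obtain z where z: "(x, z) \<in> parcs (tournament_of n u)"
          "(z, j) \<in> parcs (tournament_of n u)"
        using two_kingD[OF x, of j] jx by blast
      have "z < j"
        using z(2) unbeaten by (auto simp: tournament_of_def ordered_pairs_def)
      \<comment> \<open>Here \<open>z < j < x\<close> and \<open>x\<close> dominates
        \<open>z\<close>, so this pair is reversed; \<open>z < j \<le> k\<close> puts it in
        \<open>?R\<close>.\<close>
      then have "(z, x) \<in> ?R"
        using z(1) jx j by (auto simp: tournament_of_def ordered_pairs_def)
      then show False
        using notin by force
    qed
  qed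
  then have "card {x. two_king (tournament_of n u) x} \<le> card ({1..k} \<union> snd ` ?R)"
    using fin by (intro card_mono) auto
  also have "\<dots> \<le> card {1..k} + card (snd ` ?R)"
    by (rule card_Un_le)
  also have "\<dots> \<le> k + card ?R"
    using card_image_le[OF fin, of snd] by simp
  finally show ?thesis .
qed

section \<open>Independent Bernoulli families\<close>

lemma Pi_pmf_bernoulli_prob_none:
  fixes p :: real
  assumes "finite S" "K \<subseteq> S" "0 \<le> p" "p \<le> 1"
  shows "measure_pmf.prob (Pi_pmf S d (\<lambda>_. bernoulli_pmf p)) {u. \<forall>x\<in>K. \<not> u x} = (1 - p) ^ card K"
proof -
  \<comment> \<open>Coordinates outside \<open>K\<close> are left free and contribute a factor 1 to
    the product over \<open>S\<close>.\<close>
  have eq: "{u. \<forall>x\<in>K. \<not> u x} = Pi S (\<lambda>x. if x \<in> K then {False} else UNIV)"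
    using assms(2) by (auto simp: Pi_def split: if_splits)
  have "measure_pmf.prob (Pi_pmf S d (\<lambda>_. bernoulli_pmf p)) {u. \<forall>x\<in>K. \<not> u x}
      = (\<Prod>x\<in>S. measure_pmf.prob (bernoulli_pmf p) (if x \<in> K then {False} else UNIV))"
    unfolding eq by (rule measure_Pi_pmf_Pi[OF assms(1)])
  also have "\<dots> = (\<Prod>x\<in>S. if x \<in> K then 1 - p else 1)"
    using assms by (intro prod.cong) (auto simp: measure_pmf_single)
  also have "\<dots> = (1 - p) ^ card K"
    using assms by (simp add: prod.If_cases Int_absorb1)
  finally show ?thesis .
qed

text \<open>Restrictions of an independent family to disjoint index blocks are independent, so the
  probabilities of hitting the single blocks multiply.\<close>

lemma Pi_pmf_bernoulli_prob_all_blocks_hit: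
  fixes p :: real
  assumes S: "finite S" and L: "finite L" "L \<noteq> {}"
    and K: "\<And>j. j \<in> L \<Longrightarrow> K j \<subseteq> S" "disjoint_family_on K L" and p: "0 \<le> p" "p \<le> 1"
  shows "measure_pmf.prob (Pi_pmf S d (\<lambda>_. bernoulli_pmf p)) {u. \<forall>j\<in>L. \<exists>x\<in>K j. u x}
           = (\<Prod>j\<in>L. 1 - (1 - p) ^ card (K j))"
proof -
  let ?M = "Pi_pmf S d (\<lambda>_. bernoulli_pmf p)"
  have "prob_space.indep_vars ?M (\<lambda>_. count_space UNIV) (\<lambda>x u. u x) S"
    by (rule indep_vars_Pi_pmf[OF S])
  then have "prob_space.indep_vars ?M (\<lambda>j. PiM (K j) (\<lambda>_. count_space UNIV))
      (\<lambda>j u. restrict (\<lambda>x. u x) (K j)) L"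
    using K by (intro prob_space.indep_vars_restrict[OF measure_pmf.prob_space_axioms]) auto
  then have "prob_space.indep_vars ?M (\<lambda>_. count_space UNIV)
      (\<lambda>j u. \<exists>x\<in>K j. restrict (\<lambda>x. u x) (K j) x) L"
  proof (rule prob_space.indep_vars_compose2[OF measure_pmf.prob_space_axioms])
    fix j assume j: "j \<in> L"
    \<comment> \<open>Finiteness turns the bounded quantifier into a finite union of measurable
      events in the product space.\<close>
    have [measurable]: "finite (K j)"
      using K(1)[OF j] S finite_subset by blast
    show "(\<lambda>f. \<exists>x\<in>K j. f x) \<in> PiM (K j) (\<lambda>_. count_space UNIV) \<rightarrow>\<^sub>M count_space UNIV"
      by measurable
  qed
  from prob_space.indep_varsD_finite[OF measure_pmf.prob_space_axioms this L(2,1), of "\<lambda>_. {True}"]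
  have "measure_pmf.prob ?M (\<Inter>j\<in>L. {u. \<exists>x\<in>K j. u x})
      = (\<Prod>j\<in>L. measure_pmf.prob ?M {u. \<exists>x\<in>K j. u x})"
    by (simp add: vimage_def)
  moreover have "measure_pmf.prob ?M {u. \<exists>x\<in>K j. u x} = 1 - (1 - p) ^ card (K j)" if "j \<in> L" for j
  proof -
    have "{u. \<exists>x\<in>K j. u x} = space ?M - {u. \<forall>x\<in>K j. \<not> u x}"
      by auto
    then have "measure_pmf.prob ?M {u. \<exists>x\<in>K j. u x} = 1 - measure_pmf.prob ?M {u. \<forall>x\<in>K j. \<not> u x}"
      by (simp only: measure_pmf.prob_compl sets_measure_pmf UNIV_I)
    then show ?thesis
      by (simp only: Pi_pmf_bernoulli_prob_none[OF S K(1)[OF that] p])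
  qed
  moreover have "(\<Inter>j\<in>L. {u. \<exists>x\<in>K j. u x}) = {u. \<forall>j\<in>L. \<exists>x\<in>K j. u x}"
    by auto
  ultimately show ?thesis
    by simp
qed

text \<open>Linearity of expectation over the indicators of the single coordinates, each of which
  has mean \<open>p\<close>.\<close>

lemma expectation_card_Pi_pmf_bernoulli:
  fixes p :: real
  assumes "finite S" "A \<subseteq> S" "0 \<le> p" "p \<le> 1"
  shows "measure_pmf.expectation (Pi_pmf S d (\<lambda>_. bernoulli_pmf p))
           (\<lambda>u. real (card {x \<in> A. u x})) = card A * p"
proof -
  let ?M = "Pi_pmf S d (\<lambda>_. bernoulli_pmf p)"
  have A: "finite A"
    using assms(1,2) by (rule finite_subset[rotated])
  have "measure_pmf.expectation ?M (\<lambda>u. real (card {x \<in> A. u x}))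
      = measure_pmf.expectation ?M (\<lambda>u. \<Sum>x\<in>A. indicator {u. u x} u)"
    using A by (simp add: indicator_def sum.If_cases Int_def)
  also have "\<dots> = (\<Sum>x\<in>A. measure_pmf.prob ?M {u. u x})"
    by (subst Bochner_Integration.integral_sum)
      (simp_all add: integrable_measure_pmf_finite set_Pi_pmf assms finite_PiE_dflt)
  also have "\<dots> = (\<Sum>x\<in>A. p)"
  proof (rule sum.cong[OF refl])
    fix x assume "x \<in> A"
    then have "map_pmf (\<lambda>u. u x) ?M = bernoulli_pmf p"
      using assms by (simp add: Pi_pmf_component subset_iff)
    moreover have "measure_pmf.prob ?M {u. u x} = measure_pmf.prob (map_pmf (\<lambda>u. u x) ?M) {True}"
      by (simp add: vimage_def)
    ultimately show "measure_pmf.prob ?M {u. u x} = p"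
      using assms by (simp add: measure_pmf_single)
  qed
  finally show ?thesis
    by simp
qed

section \<open>Probability bounds in the Condorcet model\<close>

text \<open>The pairs with smaller index \<open>j\<close> form one block of at most \<open>n\<close>
  coordinates, and blocks for different \<open>j\<close> are disjoint. Each factor of the resulting
  product is bounded by \<open>1 - y \<le> exp (- y)\<close>.\<close>

lemma condorcet_prob_no_unbeaten_le:
  fixes n k :: nat and p :: real
  assumes k: "1 \<le> k" "k \<le> n" and p: "0 \<le> p" "p \<le> 1"
  shows "measure_pmf.prob (Pi_pmf (ordered_pairs n) False (\<lambda>_. bernoulli_pmf p))
           {u. \<forall>j\<in>{1..k}. \<exists>l. (j, l) \<in> ordered_pairs n \<and> u (j, l)}
         \<le> exp (- (real k * (1 - p) ^ n))"
proof -
  let ?M = "Pi_pmf (ordered_pairs n) False (\<lambda>_. bernoulli_pmf p)"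
  define K where "K = (\<lambda>j::nat. Pair j ` {j<..n})"
  have "{u. \<forall>j\<in>{1..k}. \<exists>l. (j, l) \<in> ordered_pairs n \<and> u (j, l)}
      = {u. \<forall>j\<in>{1..k}. \<exists>e\<in>K j. u e}"
    by (intro Collect_cong ball_cong refl) (auto simp: K_def ordered_pairs_def)
  also have "measure_pmf.prob ?M \<dots> = (\<Prod>j\<in>{1..k}. 1 - (1 - p) ^ card (K j))"
    using k p by (intro Pi_pmf_bernoulli_prob_all_blocks_hit finite_ordered_pairs)
      (auto simp: K_def ordered_pairs_def disjoint_family_on_def)
  also have "\<dots> \<le> (\<Prod>j\<in>{1..k}. exp (- ((1 - p) ^ n)))"
  proof (rule prod_mono)
    fix j assume "j \<in> {1..k}"
    have "(1 - p) ^ n \<le> (1 - p) ^ card (K j)"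
      using p by (intro power_decreasing) (auto simp: K_def card_image inj_on_def)
    moreover have "(1 - p) ^ card (K j) \<le> 1"
      using p by (intro power_le_one) auto
    moreover have "1 + - ((1 - p) ^ n) \<le> exp (- ((1 - p) ^ n))"
      by (rule exp_ge_add_one_self)
    ultimately show "0 \<le> 1 - (1 - p) ^ card (K j) \<and> 1 - (1 - p) ^ card (K j) \<le> exp (- ((1 - p) ^ n))"
      by linarith
  qed
  also have "\<dots> = exp (- (real k * (1 - p) ^ n))"
    by (simp flip: exp_of_nat_mult)
  finally show ?thesis .
qed

text \<open>Markov's inequality; at most \<open>k * n\<close> pairs have smaller index at most
  \<open>k\<close>, which bounds the expectation.\<close>

lemma condorcet_prob_many_reversed_le:
  fixes n k :: nat and p :: real
  assumes p: "0 \<le> p" "p \<le> 1" and t: "0 < t"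
  shows "measure_pmf.prob (Pi_pmf (ordered_pairs n) False (\<lambda>_. bernoulli_pmf p))
           {u. t \<le> real (k + card {e \<in> ordered_pairs n. fst e \<le> k \<and> u e})}
         \<le> (k + k * n * p) / t"
proof -
  let ?M = "Pi_pmf (ordered_pairs n) False (\<lambda>_. bernoulli_pmf p)"
  define A where "A = {e \<in> ordered_pairs n. fst e \<le> k}"
  have A: "A \<subseteq> ordered_pairs n" "finite A"
    using finite_ordered_pairs by (auto simp: A_def)
  have "card A \<le> card ({1..k} \<times> {1..n})"
    by (rule card_mono) (auto simp: A_def ordered_pairs_def)
  then have card_A: "card A \<le> k * n"
    by simp
  have int: "integrable ?M f" for f :: "_ \<Rightarrow> real"
    by (rule integrable_measure_pmf_finite) (simp add: set_Pi_pmf finite_ordered_pairs finite_PiE_dflt)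
  have "measure_pmf.prob ?M {u \<in> space ?M. t \<le> real k + real (card {e \<in> A. u e})}
      \<le> measure_pmf.expectation ?M (\<lambda>u. real k + real (card {e \<in> A. u e})) / t"
    using t by (intro integral_Markov_inequality_measure[where A = "{}"] int) auto
  also have "measure_pmf.expectation ?M (\<lambda>u. real k + real (card {e \<in> A. u e})) = k + card A * p"
    using expectation_card_Pi_pmf_bernoulli[OF finite_ordered_pairs A(1) p, of False]
    by (subst Bochner_Integration.integral_add[OF int int]) simp
  also have "(k + card A * p) / t \<le> (k + k * n * p) / t"
    using card_A p t by (intro divide_right_mono add_left_mono mult_right_mono) (auto simp flip: of_nat_mult)
  finally show ?thesis
    by (simp add: A_def conj_assoc)
qed

text \<open>Union bound: outside \<open>?B\<close> some \<open>j \<le> k\<close> loses to no later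
  alternative, and the deterministic count then forces \<open>?C\<close>.\<close>

lemma condorcet_prob_many_two_kings_le:
  fixes n k :: nat and p :: real
  assumes k: "1 \<le> k" "k \<le> n" and p: "0 \<le> p" "p \<le> 1" and t: "0 < t"
  shows "measure_pmf.prob (condorcet_model n p) {T. \<not> real (card {x. two_king T x}) \<le> t}
         \<le> exp (- (real k * (1 - p) ^ n)) + (k + k * n * p) / t"
proof -
  let ?M = "Pi_pmf (ordered_pairs n) False (\<lambda>_. bernoulli_pmf p)"
  let ?B = "{u. \<forall>j\<in>{1..k}. \<exists>l. (j, l) \<in> ordered_pairs n \<and> u (j, l)}"
  let ?C = "{u. t \<le> real (k + card {e \<in> ordered_pairs n. fst e \<le> k \<and> u e})}"
  have "tournament_of n -` {T. \<not> real (card {x. two_king T x}) \<le> t} \<subseteq> ?B \<union> ?C"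
  proof
    fix u assume u: "u \<in> tournament_of n -` {T. \<not> real (card {x. two_king T x}) \<le> t}"
    show "u \<in> ?B \<union> ?C"
    proof (cases "u \<in> ?B")
      case False
      then obtain j where "j \<in> {1..k}" "\<And>l. (j, l) \<in> ordered_pairs n \<Longrightarrow> \<not> u (j, l)"
        by blast
      then have "card {x. two_king (tournament_of n u) x}
          \<le> k + card {e \<in> ordered_pairs n. fst e \<le> k \<and> u e}"
        by (intro card_two_kings_le k)
      with u show ?thesis
        by (auto simp flip: of_nat_add)
    qed simp
  qed
  then have "measure_pmf.prob (condorcet_model n p) {T. \<not> real (card {x. two_king T x}) \<le> t}
      \<le> measure_pmf.prob ?M (?B \<union> ?C)"
    unfolding condorcet_model_def measure_map_pmf by (intro measure_pmf.finite_measure_mono) auto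
  also have "\<dots> \<le> measure_pmf.prob ?M ?B + measure_pmf.prob ?M ?C"
    by (rule measure_Un_le) auto
  also have "\<dots> \<le> exp (- (real k * (1 - p) ^ n)) + (k + k * n * p) / t"
    by (intro add_mono condorcet_prob_no_unbeaten_le condorcet_prob_many_reversed_le assms)
  finally show ?thesis .
qed

section \<open>Choice of parameters and asymptotics\<close>

text \<open>For \<open>x \<le> 1 / 2\<close> the quadratic term in the lower bound for
  \<open>ln (1 - x)\<close> is at most \<open>x\<close>, whence the factor 2.\<close>

lemma one_minus_ge_exp:
  fixes x :: real
  assumes "0 \<le> x" "x \<le> 1 / 2"
  shows "exp (- 2 * x) \<le> 1 - x"
proof -
  have "ln (1 - x) \<ge> - x - 2 * x\<^sup>2"
    using assms by (rule ln_one_minus_pos_lower_bound)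
  moreover have "2 * x\<^sup>2 \<le> x"
    using mult_right_mono[OF assms(2,1)] by (simp add: power2_eq_square)
  ultimately have "- 2 * x \<le> ln (1 - x)"
    by simp
  then show ?thesis
    using assms by (subst (asm) ln_ge_iff) auto
qed

theorem theorem8:
  fixes p :: "nat \<Rightarrow> real"
  assumes "\<And>n. n \<ge> 1 \<Longrightarrow> 0 \<le> p n \<and> p n \<le> 1 / 2"
    and "\<And>n. n \<ge> 1 \<Longrightarrow> p n \<le> 0.1 * ln (real n) / real n"
  shows "(\<lambda>n. measure_pmf.prob (condorcet_model n (p n))
            {T. real (card {x. two_king T x}) \<le> sqrt (real n) * ln (real n)})
          \<longlonglongrightarrow> 1"
proof -
  define P where "P = (\<lambda>n. measure_pmf.prob (condorcet_model n (p n))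
            {T. real (card {x. two_king T x}) \<le> sqrt (real n) * ln (real n)})"
  \<comment> \<open>For \<open>k\<close> the floor of \<open>n powr 0.4\<close>, the first exponent
    is of order \<open>- (n powr 0.2)\<close> and the second term of order
    \<open>n powr (- 0.1)\<close>. Any exponent strictly between 0.2 and 0.5 in place of 0.4 would
    make both vanish.\<close>
  define err :: "nat \<Rightarrow> real" where "err = (\<lambda>n.
      exp (- ((real n powr 0.4 - 1) * real n powr (- 0.2)))
      + (real n powr 0.4 * (1 + 0.1 * ln (real n))) / (sqrt (real n) * ln (real n)))"
  \<comment> \<open>From \<open>n = 2\<close> on, \<open>ln n\<close> is positive, so the threshold
    is positive as Markov's inequality requires.\<close>
  have lower: "1 - err n \<le> P n" if n: "2 \<le> n" for n
  proof -
    define k where "k = nat \<lfloor>real n powr 0.4\<rfloor>"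
    have pn: "0 \<le> p n" "p n \<le> 1 / 2" "p n \<le> 0.1 * ln n / n"
      using assms n by auto
    have npn: "n * p n \<le> 0.1 * ln n"
      using pn(3) n by (simp add: field_simps)
    have "1 \<le> real n powr 0.4"
      using n by (intro ge_one_powr_ge_zero) auto
    then have k1: "1 \<le> k" and kle: "real k \<le> real n powr 0.4" and kge: "real n powr 0.4 - 1 \<le> real k"
      unfolding k_def by linarith+
    have "real n powr 0.4 \<le> real n powr 1"
      using n by (intro powr_mono) auto
    with kle have kn: "k \<le> n"
      by simp
    have t: "0 < sqrt n * ln n"
      using n by simp
    \<comment> \<open>The exponent 0.2 is twice the constant 0.1 bounding
      \<open>n * p n / ln n\<close>; the factor 2 comes from
      \<open>one_minus_ge_exp\<close>.\<close>
    have "real n powr (- 0.2) = exp (- 0.2 * ln n)"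
      using n by (simp add: powr_def)
    also have "\<dots> \<le> exp (n * (- 2 * p n))"
      using npn by simp
    also have "\<dots> = exp (- 2 * p n) ^ n"
      by (rule exp_of_nat_mult)
    also have "\<dots> \<le> (1 - p n) ^ n"
      by (intro power_mono one_minus_ge_exp pn) auto
    finally have pow: "real n powr (- 0.2) \<le> (1 - p n) ^ n" .
    have "(real n powr 0.4 - 1) * real n powr (- 0.2) \<le> k * (1 - p n) ^ n"
      using kge pow by (intro mult_mono) auto
    moreover have "k + k * n * p n \<le> real n powr 0.4 * (1 + 0.1 * ln n)"
    proof -
      have "k + k * n * p n = k * (1 + n * p n)"
        by (simp add: algebra_simps)
      also have "\<dots> \<le> real n powr 0.4 * (1 + 0.1 * ln n)"
        using kle npn pn(1) by (intro mult_mono) auto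
      finally show ?thesis .
    qed
    ultimately have "exp (- (real k * (1 - p n) ^ n)) + (k + k * n * p n) / (sqrt n * ln n) \<le> err n"
      unfolding err_def using t by (intro add_mono divide_right_mono) auto
    moreover have "measure_pmf.prob (condorcet_model n (p n))
        {T. \<not> real (card {x. two_king T x}) \<le> sqrt n * ln n} = 1 - P n"
      unfolding P_def
      using measure_pmf.prob_compl[of "{T. real (card {x. two_king T x}) \<le> sqrt n * ln n}"
          "condorcet_model n (p n)"]
      by (simp add: set_diff_eq)
    ultimately show ?thesis
      using condorcet_prob_many_two_kings_le[OF k1 kn pn(1) _ t] pn(2) by simp
  qed
  have "(\<lambda>n. 1 - err n) \<longlonglongrightarrow> 1"
    unfolding err_def by real_asymp
  then have "P \<longlonglongrightarrow> 1"
  proof (rule tendsto_sandwich[rotated 2])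
    show "\<forall>\<^sub>F n in sequentially. 1 - err n \<le> P n"
      using eventually_ge_at_top[of 2] by eventually_elim (rule lower)
    show "\<forall>\<^sub>F n in sequentially. P n \<le> 1"
      by (simp add: P_def)
  qed simp
  then show ?thesis
    unfolding P_def .
qed

end
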